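(* Let $k$ be a positive integer. Then for all sufficiently large $n$, $$\mathrm{bp}_k(K_n) \leq n + 2kn^{3/4} + k\sqrt{n}.$$
   Context: A biclique of a graph $G$ is a (not necessarily induced) subgraph of $G$ isomorphic to a complete bipartite graph $K_{s,t}$ with $s,t \geq 1$. For a positive integer $k$, $\mathrm{bp}_k(G)$ denotes the size $\ell$ of the smallest collection $\{H_1,\dots,H_\ell\}$ of bicliques $H_i \subset G$ (a biclique may be repeated) such that each edge of $G$ belongs to $H_i$ for exactly $k$ different values of $i \in \{1,\dots,\ell\}$. $K_n$ is the complete graph on $n$ vertices. "Sufficiently large" may depend on $k$. *)

theory Defs
  imports Complex_Main "Graph_Theory.Graph_Theory"
begin

text \<open>
  As in \<^theory>\<open>Graph_Theory.Kuratowski\<close>, an undirected simple graph is a finite symmetric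
  digraph without loops and parallel arcs (locale \<^locale>\<open>graph\<close>): an edge $\{u, v\}$ is the pair
  of arcs from $u$ to $v$ and from $v$ to $u$.
\<close>

definition biclique :: "('a, 'b) pre_digraph \<Rightarrow> ('a, 'b) pre_digraph \<Rightarrow> bool" where
  "biclique H G \<longleftrightarrow> subgraph H G \<and> (\<exists>s t. s \<ge> 1 \<and> t \<ge> 1 \<and> K\<^bsub>s,t\<^esub> H)"

text \<open>
  Collections are lists, so that a biclique may be repeated. A biclique is symmetric, hence it
  contains both arcs of an edge or neither, and counting per arc is the same as counting per edge.
\<close>

definition biclique_cover :: "nat \<Rightarrow> ('a, 'b) pre_digraph \<Rightarrow> ('a, 'b) pre_digraph list \<Rightarrow> bool" where
  "biclique_cover k G Hs \<longleftrightarrow>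
     (\<forall>H \<in> set Hs. biclique H G) \<and>
     (\<forall>e \<in> arcs G. card {i. i < length Hs \<and> e \<in> arcs (Hs ! i)} = k)"

text \<open>The minimum is over a nonempty set by \<open>biclique_cover_exists\<close> below.\<close>

definition bp :: "nat \<Rightarrow> ('a, 'b) pre_digraph \<Rightarrow> nat" where
  "bp k G = (LEAST l. \<exists>Hs. biclique_cover k G Hs \<and> length Hs = l)"

lemma biclique_arc_sym:
  assumes "graph G" "biclique H G" "e \<in> arcs H" "e' \<in> arcs G"
    and "tail G e' = head G e" "head G e' = tail G e"
  shows "e' \<in> arcs H"
proof -
  interpret G: graph G by fact
  obtain s t where "K\<^bsub>s,t\<^esub> H" and sub: "subgraph H G"
    using assms(2) by (auto simp: biclique_def)
  then interpret H: graph H by (simp add: complete_bipartite_digraph_def)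
  have eq: "tail G = tail H" "head G = head H"
    using sub by (auto simp: subgraph_def compatible_def)
  have "(tail H e, head H e) \<in> arcs_ends H"
    using assms(3) by (auto simp: arcs_ends_def arc_to_ends_def)
  then have "(head H e, tail H e) \<in> arcs_ends H"
    using H.sym_arcs by (auto simp: symmetric_def dest: symD)
  then obtain e'' where e'': "e'' \<in> arcs H" "tail H e'' = head H e" "head H e'' = tail H e"
    by (auto simp: arcs_ends_def arc_to_ends_def)
  then have "e'' \<in> arcs G" using sub by (auto simp: subgraph_def)
  then have "e'' = e'"
    using e'' assms eq G.no_multi_arcs[of e'' e'] by (simp add: arc_to_ends_def)
  then show ?thesis using e'' by simp
qed

lemma biclique_cover_exists:
  fixes G :: "('a, 'b) pre_digraph"
  assumes "graph G"
  shows "\<exists>Hs. biclique_cover k G Hs"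
proof -
  interpret G: graph G by fact
  define S where "S P = \<lparr>verts = P, arcs = {e \<in> arcs G. {tail G e, head G e} = P},
      tail = tail G, head = head G\<rparr>" for P
  have S: "biclique (S {tail G e, head G e}) G" if e: "e \<in> arcs G" for e
  proof -
    let ?u = "tail G e" and ?v = "head G e"
    let ?S = "S {?u, ?v}"
    have uv: "?u \<noteq> ?v" using e G.no_loops by auto
    have 1: "(?u, ?v) \<in> arcs_ends G" using e by (auto simp: arcs_ends_def arc_to_ends_def)
    then have 2: "(?v, ?u) \<in> arcs_ends G"
      using G.sym_arcs by (auto simp: symmetric_def dest: symD)
    have ends: "arcs_ends ?S = {?u} \<times> {?v} \<union> {?v} \<times> {?u}"
      using 1 2 by (force simp: S_def arcs_ends_def arc_to_ends_def doubleton_eq_iff)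
    have wf: "wf_digraph ?S" by unfold_locales (auto simp: S_def)
    have gr: "graph ?S"
    proof unfold_locales
      show "symmetric ?S" unfolding symmetric_def ends by (auto intro: symI)
      show "a = b" if "a \<in> arcs ?S" "b \<in> arcs ?S" "arc_to_ends ?S a = arc_to_ends ?S b" for a b
        using that G.no_multi_arcs[of a b] by (auto simp: S_def arc_to_ends_def)
    qed (use G.no_loops in \<open>auto simp: S_def\<close>)
    have "subgraph ?S G"
      using wf G.wf_digraph e by (auto simp: subgraph_def compatible_def S_def)
    moreover have "K\<^bsub>1,1\<^esub> ?S"
      unfolding complete_bipartite_digraph_def
      using gr ends uv by (intro conjI exI[of _ "{?u}"] exI[of _ "{?v}"]) (auto simp: S_def)
    ultimately show ?thesis unfolding biclique_def by blast
  qed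
  define E where "E = (\<lambda>e. {tail G e, head G e}) ` arcs G"
  have "finite E" unfolding E_def using G.finite_arcs by simp
  then obtain Ps where Ps: "set Ps = E" "distinct Ps" using finite_distinct_list by blast
  define Hs where "Hs = concat (replicate k (map S Ps))"
  have "card {i. i < length Hs \<and> e \<in> arcs (Hs ! i)} = k" if e: "e \<in> arcs G" for e
  proof -
    let ?P = "{tail G e, head G e}"
    have "filter (\<lambda>P. P = ?P) Ps = [?P]"
    proof -
      have "?P \<in> set Ps" using Ps e by (auto simp: E_def)
      moreover have "distinct Ps" by fact
      ultimately show ?thesis
        by (induction Ps) (auto simp: filter_empty_conv)
    qed
    moreover have "e \<in> arcs (S P) \<longleftrightarrow> P = ?P" for P using e by (auto simp: S_def)
    ultimately have "length (filter (\<lambda>H. e \<in> arcs H) (map S Ps)) = 1"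
      by (simp add: filter_map o_def)
    then have "length (filter (\<lambda>H. e \<in> arcs H) Hs) = k"
      unfolding Hs_def by (induction k) auto
    then show ?thesis by (simp add: length_filter_conv_card)
  qed
  moreover have "biclique H G" if "H \<in> set Hs" for H
    using that Ps S by (auto simp: Hs_def E_def split: if_splits)
  ultimately show ?thesis unfolding biclique_cover_def by blast
qed

end

theory Submission
  imports Defs "HOL-Real_Asymp.Real_Asymp"
begin

text \<open>
  Any simple graph on $n$ vertices splits into at most $n$ stars: number the vertices and give
  every edge to its smaller endpoint. The bound leaves room for one such family of stars, so it
  suffices to cover the complete graph by $O(\sqrt{n})$ bicliques in such a way that every edge is covered $k$ or $k - 1$
  times; the edges covered only $k - 1$ times form a simple graph, which stars repair.

  Such a near-cover comes from $k$ vertex colourings such that two distinct vertices share their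
  colour in at most one of them. The edges that are bichromatic for a colouring with $M$ colours
  form a complete multipartite graph, which splits into at most $M$ bicliques (one colour against
  all larger ones). Doing this for every colouring takes $kM$ bicliques and covers each edge $k$
  times, minus the number of colourings, $0$ or $1$, in which its endpoints agree. Altogether
  \<open>bp_le_of_colourings\<close> gives $n + kM$.

  For the colourings, place the vertices at the points $(x, y)$ of a $q \times q$ grid, with
  $q = \lceil \sqrt{n} \rceil$. Colouring number $i$ is $ix + y$, whose colour classes lie on
  parallel lines of slope $-i$; two points lie on only one common line, so they agree at most once.
  As $ix + y < kq$ for $i < k$, this yields \<open>bp_le_of_grid\<close>, the bound $n + k^2 q$. Since
  $q \le \sqrt{n} + 1$, the error is of order $\sqrt{n}$ for fixed $k$, hence eventually below
  $2 k n^{3/4}$.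
\<close>

section \<open>Bicliques of a complete graph\<close>

definition complete_between :: "('a, 'b) pre_digraph \<Rightarrow> 'a set \<Rightarrow> 'a set \<Rightarrow> ('a, 'b) pre_digraph" where
  "complete_between G A B = \<lparr>verts = A \<union> B,
     arcs = {e \<in> arcs G. (tail G e, head G e) \<in> A \<times> B \<union> B \<times> A},
     tail = tail G, head = head G\<rparr>"

lemma biclique_complete_between:
  fixes G :: "('a, 'b) pre_digraph"
  assumes K: "K\<^bsub>n\<^esub> G" and AB: "A \<subseteq> verts G" "B \<subseteq> verts G" "A \<inter> B = {}" "A \<noteq> {}" "B \<noteq> {}"
  shows "biclique (complete_between G A B) G"
proof -
  from K interpret G: graph G by (simp add: complete_digraph_def)
  let ?S = "complete_between G A B"
  have endsG: "arcs_ends G = {(u,v). (u,v) \<in> verts G \<times> verts G \<and> u \<noteq> v}"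
    using K by (simp add: complete_digraph_def)
  have "arcs_ends ?S = arcs_ends G \<inter> (A \<times> B \<union> B \<times> A)"
    by (auto simp: complete_between_def arcs_ends_def arc_to_ends_def)
  also have "\<dots> = A \<times> B \<union> B \<times> A"
    unfolding endsG using AB by auto
  finally have ends: "arcs_ends ?S = A \<times> B \<union> B \<times> A" .
  have fin: "finite A" "finite B"
    using AB G.finite_verts finite_subset by blast+
  have wf: "wf_digraph ?S" by unfold_locales (auto simp: complete_between_def)
  have gr: "graph ?S"
  proof unfold_locales
    show "symmetric ?S" unfolding symmetric_def ends by (auto intro: symI)
    show "a = b" if "a \<in> arcs ?S" "b \<in> arcs ?S" "arc_to_ends ?S a = arc_to_ends ?S b" for a b
      using that G.no_multi_arcs[of a b] by (auto simp: complete_between_def arc_to_ends_def)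
  qed (use G.no_loops fin in \<open>auto simp: complete_between_def\<close>)
  have "subgraph ?S G"
    using wf G.wf_digraph AB by (auto simp: subgraph_def compatible_def complete_between_def)
  moreover have "K\<^bsub>card A,card B\<^esub> ?S"
    unfolding complete_bipartite_digraph_def
    using gr ends AB by (intro conjI exI[of _ A] exI[of _ B]) (auto simp: complete_between_def)
  moreover have "card A \<ge> 1" "card B \<ge> 1"
    using fin AB by (simp_all add: Suc_le_eq card_gt_0_iff)
  ultimately show ?thesis unfolding biclique_def by blast
qed

text \<open>
  This reduces bounds on \<^term>\<open>bp k G\<close> to counting pairs of vertex sets. Pairs with an empty side,
  which give no biclique, may occur in the family: they separate no two vertices, so they can be
  dropped.
\<close>

lemma bp_le_card_separating_family:
  fixes G :: "('a, 'b) pre_digraph" and J :: "'i set" and A B :: "'i \<Rightarrow> 'a set"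
  assumes K: "K\<^bsub>n\<^esub> G" and "finite J"
    and AB: "\<And>j. j \<in> J \<Longrightarrow> A j \<subseteq> verts G \<and> B j \<subseteq> verts G \<and> A j \<inter> B j = {}"
    and count: "\<And>u v. u \<in> verts G \<Longrightarrow> v \<in> verts G \<Longrightarrow> u \<noteq> v \<Longrightarrow>
      card {j \<in> J. (u, v) \<in> A j \<times> B j \<union> B j \<times> A j} = k"
  shows "bp k G \<le> card J"
proof -
  from K interpret G: graph G by (simp add: complete_digraph_def)
  define J' where "J' = {j \<in> J. A j \<noteq> {} \<and> B j \<noteq> {}}"
  have "finite J'" using \<open>finite J\<close> by (simp add: J'_def)
  then obtain js where js: "set js = J'" "distinct js" using finite_distinct_list by blast
  define Hs where "Hs = map (\<lambda>j. complete_between G (A j) (B j)) js"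
  have "card {i. i < length Hs \<and> e \<in> arcs (Hs ! i)} = k" if e: "e \<in> arcs G" for e
  proof -
    let ?sep = "\<lambda>j. (tail G e, head G e) \<in> A j \<times> B j \<union> B j \<times> A j"
    have "card {i. i < length Hs \<and> e \<in> arcs (Hs ! i)} = length (filter (\<lambda>H. e \<in> arcs H) Hs)"
      by (simp add: length_filter_conv_card)
    also have "\<dots> = length (filter ?sep js)"
      using e by (simp add: Hs_def filter_map o_def complete_between_def)
    also have "\<dots> = card (set (filter ?sep js))"
      using js by (intro distinct_card[symmetric]) simp
    also have "set (filter ?sep js) = {j \<in> J. ?sep j}"
      using js by (auto simp: J'_def)
    also have "card \<dots> = k"
      using e G.no_loops by (intro count) auto
    finally show ?thesis .
  qed
  moreover have "biclique H G" if "H \<in> set Hs" for H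
  proof -
    from that obtain j where "j \<in> J'" "H = complete_between G (A j) (B j)"
      using js by (auto simp: Hs_def)
    then show ?thesis using AB by (auto simp: J'_def intro!: biclique_complete_between[OF K])
  qed
  ultimately have "biclique_cover k G Hs" unfolding biclique_cover_def by blast
  then have "bp k G \<le> length Hs" unfolding bp_def by (intro Least_le) blast
  also have "\<dots> = card J'" using js distinct_card by (fastforce simp: Hs_def)
  also have "\<dots> \<le> card J" using \<open>finite J\<close> by (auto simp: J'_def intro: card_mono)
  finally show ?thesis .
qed

section \<open>Covers from vertex colourings\<close>

text \<open>
  The index \<open>Inl (i, a)\<close> stands for the biclique between colour \<open>a\<close> and all larger colours of
  colouring \<open>i\<close>. The index \<open>Inr w\<close> stands for the star that joins \<open>w\<close> to those later vertices (in
  an arbitrary enumeration) that agree with \<open>w\<close> in some colouring. An edge that is bichromatic in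
  colouring \<open>i\<close> lies in exactly one biclique of that colouring, the one for the smaller of its two
  colours; an edge that is monochromatic in some colouring lies in exactly one star.
\<close>

lemma bp_le_of_colourings:
  fixes G :: "('a, 'b) pre_digraph" and c :: "nat \<Rightarrow> 'a \<Rightarrow> nat"
  assumes K: "K\<^bsub>n\<^esub> G"
    and range: "\<And>i v. i < k \<Longrightarrow> v \<in> verts G \<Longrightarrow> c i v < M"
    and agree_once: "\<And>i j u v. i < k \<Longrightarrow> j < k \<Longrightarrow> u \<in> verts G \<Longrightarrow> v \<in> verts G \<Longrightarrow> u \<noteq> v \<Longrightarrow>
      c i u = c i v \<Longrightarrow> c j u = c j v \<Longrightarrow> i = j"
  shows "bp k G \<le> n + k * M"
proof -
  from K interpret G: graph G by (simp add: complete_digraph_def)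
  obtain f :: "'a \<Rightarrow> nat" where f: "inj_on f (verts G)"
    using finite_imp_inj_to_nat_seg[OF G.finite_verts] by blast
  define J where "J = ({..<k} \<times> {..<M}) <+> verts G"
  define A :: "nat \<times> nat + 'a \<Rightarrow> 'a set" where
    "A = case_sum (\<lambda>(i, a). {v \<in> verts G. c i v = a}) (\<lambda>w. {w})"
  define B :: "nat \<times> nat + 'a \<Rightarrow> 'a set" where
    "B = case_sum (\<lambda>(i, a). {v \<in> verts G. a < c i v})
           (\<lambda>w. {v \<in> verts G. f w < f v \<and> (\<exists>i<k. c i w = c i v)})"
  have "bp k G \<le> card J"
  proof (rule bp_le_card_separating_family[OF K])
    show "finite J" by (simp add: J_def)
    show "A j \<subseteq> verts G \<and> B j \<subseteq> verts G \<and> A j \<inter> B j = {}" if "j \<in> J" for j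
      using that by (auto simp: J_def A_def B_def)
    fix u v assume uv: "u \<in> verts G" "v \<in> verts G" "u \<noteq> v"
    let ?sep = "\<lambda>j. (u, v) \<in> A j \<times> B j \<union> B j \<times> A j"
    define D where "D = {i. i < k \<and> c i u \<noteq> c i v}"
    define E where "E = {i. i < k \<and> c i u = c i v}"
    define s where "s = (if f u < f v then u else v)"
    have fuv: "f u \<noteq> f v" using f uv by (auto dest: inj_onD)
    have colour_part: "?sep (Inl (i, a)) \<longleftrightarrow> c i u \<noteq> c i v \<and> a = min (c i u) (c i v)" for i a
      using uv by (auto simp: A_def B_def min_def)
    have star_part: "?sep (Inr w) \<longleftrightarrow> E \<noteq> {} \<and> w = s" for w
      using uv fuv by (auto simp: A_def B_def E_def s_def)
    have "{j \<in> J. ?sep j}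
        = (\<lambda>i. (i, min (c i u) (c i v))) ` D <+> (if E = {} then {} else {s})" (is "?L = ?R")
    proof (rule set_eqI)
      fix j
      have "s \<in> verts G" using uv by (simp add: s_def)
      moreover have "min (c i u) (c i v) < M" if "i < k" for i
        using range[OF that uv(1)] by simp
      ultimately show "j \<in> ?L \<longleftrightarrow> j \<in> ?R"
      proof (cases j)
        case (Inl p)
        then obtain i a where "j = Inl (i, a)" by (cases p) auto
        then show ?thesis
          using colour_part[of i a] \<open>\<And>i. i < k \<Longrightarrow> min (c i u) (c i v) < M\<close>
          by (auto simp: J_def D_def)
      next
        case (Inr w)
        then show ?thesis using star_part[of w] \<open>s \<in> verts G\<close> by (auto simp: J_def)
      qed
    qed
    also have "card \<dots> = card D + (if E = {} then 0 else 1)"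
      by (simp add: card_Plus D_def card_image inj_on_def)
    also have "(if E = {} then 0 else 1) = card E"
    proof (cases "E = {}")
      case False
      then obtain i where "i \<in> E" by blast
      then have "E = {i}" using agree_once uv by (auto simp: E_def)
      then show ?thesis by simp
    qed simp
    also have "card D + card E = card (D \<union> E)"
      by (rule card_Un_disjoint[symmetric]) (auto simp: D_def E_def)
    also have "D \<union> E = {..<k}" by (auto simp: D_def E_def)
    finally show "card {j \<in> J. ?sep j} = k" by simp
  qed
  also have "card J = n + k * M"
    using K by (simp add: J_def card_Plus complete_digraph_def)
  finally show ?thesis .
qed

section \<open>Colouring a grid by parallel lines\<close>

text \<open>
  If the lines of slopes $-i$ and $-j$ through $(x, y)$ both pass through $(x', y')$, then
  $(i - j)(x - x') = 0$, so $i = j$ or the points coincide.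
\<close>

lemma grid_lines_meet_once:
  fixes i j x y x' y' :: nat
  assumes "i * x + y = i * x' + y'" "j * x + y = j * x' + y'" "(x, y) \<noteq> (x', y')"
  shows "i = j"
proof (rule ccontr)
  assume "i \<noteq> j"
  have "int i * int x + int y = int i * int x' + int y'"
       "int j * int x + int y = int j * int x' + int y'"
    using assms(1,2) by (simp_all flip: of_nat_mult of_nat_add)
  then have "(int i - int j) * (int x - int x') = 0"
    by (simp add: algebra_simps)
  with \<open>i \<noteq> j\<close> have "x = x'" by simp
  with assms show False by simp
qed

lemma bp_le_of_grid:
  fixes G :: "('a, 'b) pre_digraph"
  assumes K: "K\<^bsub>n\<^esub> G" and "n \<le> q * q"
  shows "bp k G \<le> n + k * (k * q)"
proof -
  from K interpret G: graph G by (simp add: complete_digraph_def)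
  obtain g where g: "bij_betw g (verts G) {0..<n}"
    using K ex_bij_betw_finite_nat[OF G.finite_verts] by (auto simp: complete_digraph_def)
  define c where "c i v = i * (g v div q) + g v mod q" for i v
  show ?thesis
  proof (rule bp_le_of_colourings[OF K, where c = c])
    fix i v assume "i < k" "v \<in> verts G"
    have "g v < n" using bij_betwE[OF g] \<open>v \<in> verts G\<close> by auto
    then have "g v < q * q" using \<open>n \<le> q * q\<close> by simp
    then have q: "q > 0" "g v div q < q" by (auto simp: less_mult_imp_div_less intro: Nat.gr0I)
    then have "c i v < i * q + q"
      unfolding c_def by (intro add_le_less_mono mult_le_mono) auto
    also have "\<dots> = Suc i * q" by simp
    also have "\<dots> \<le> k * q" using \<open>i < k\<close> by (intro mult_le_mono) auto
    finally show "c i v < k * q" .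
  next
    fix i j u v
    assume uv: "u \<in> verts G" "v \<in> verts G" "u \<noteq> v" and eq: "c i u = c i v" "c j u = c j v"
    have "g u \<noteq> g v" using g uv by (auto simp: bij_betw_def dest: inj_onD)
    then have "(g u div q, g u mod q) \<noteq> (g v div q, g v mod q)"
      by (metis div_mult_mod_eq prod.inject)
    with eq show "i = j" unfolding c_def by (rule grid_lines_meet_once)
  qed
qed

section \<open>The asymptotic bound\<close>

theorem theorem2p6:
  fixes k :: nat
  assumes "k \<ge> 1"
  shows "\<forall>\<^sub>F n in sequentially. \<forall>G :: ('a, 'b) pre_digraph. K\<^bsub>n\<^esub> G \<longrightarrow>
    real (bp k G) \<le> real n + 2 * real k * real n powr (3 / 4) + real k * sqrt (real n)"
proof -
  have "real k > 0" using assms by simp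
  then have "\<forall>\<^sub>F n in sequentially. real k * (real k * (sqrt (real n) + 1))
      \<le> 2 * real k * real n powr (3 / 4) + real k * sqrt (real n)"
    by real_asymp
  then show ?thesis
  proof eventually_elim
    case (elim n)
    show ?case
    proof (intro allI impI)
      fix G :: "('a, 'b) pre_digraph"
      assume K: "K\<^bsub>n\<^esub> G"
      define q where "q = nat \<lceil>sqrt (real n)\<rceil>"
      have q: "sqrt (real n) \<le> real q" "real q \<le> sqrt (real n) + 1"
        unfolding q_def using real_sqrt_ge_zero[of "real n"] by linarith+
      have "real n = sqrt (real n) * sqrt (real n)" by simp
      also have "\<dots> \<le> real q * real q" using q by (intro mult_mono) auto
      finally have "n \<le> q * q" by (simp flip: of_nat_mult)
      then have "bp k G \<le> n + k * (k * q)" by (rule bp_le_of_grid[OF K])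
      then have "real (bp k G) \<le> real n + real k * (real k * real q)"
        by (simp flip: of_nat_mult of_nat_add)
      also have "real k * (real k * real q) \<le> real k * (real k * (sqrt (real n) + 1))"
        using q by (intro mult_left_mono) auto
      also note elim
      finally show "real (bp k G)
          \<le> real n + 2 * real k * real n powr (3 / 4) + real k * sqrt (real n)"
        by simp
    qed
  qed
qed

end
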